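(* Let $R$ and $S$ be reduced rings where $R$ is weakly Baer, and let $\phi\colon R\to S$ be a surjective ring homomorphism such that $\phi(\mathbf{B}(R))=\mathbf{B}(S)$. If $\{s_n\}_{n\in\mathbf{N}}$ is an rr-orthogonal set in $S$, then it lifts, via $\phi$, to an rr-orthogonal set in $R$; that is, there is an rr-orthogonal set $\{r_n\}_{n\in\mathbf{N}}$ in $R$ with $\phi(r_n)=s_n$ for all $n\in\mathbf{N}$.
   Context: All rings are unitary (not necessarily commutative) and reduced (no non-zero nilpotent elements). In a reduced ring $R$ all idempotents are central and left and right annihilators of an element $r$ coincide, denoted $\mathrm{ann}\, r$. $\mathbf{B}(R)$ denotes the set of idempotents of $R$. The reduced ring order (rr-order) on $R$ is the partial order $a\le_{\mathrm{rr}} b$ if and only if $ab=a^2$; infima in this order are written $a\wedge_{\mathrm{rr}} b$. Elements $r,s$ of a reduced ring are rr-orthogonal if $r\wedge_{\mathrm{rr}} s=0$, i.e. $0$ is the only common rr-lower bound of $r$ and $s$; an indexed set $\{r_n\}_{n\in\mathbf{N}}$ is rr-orthogonal if $r_i$ and $r_j$ are rr-orthogonal for all $i\neq j$. A reduced ring $R$ is weakly Baer if for each $r\in R$ there is $e\in\mathbf{B}(R)$ with $\mathrm{ann}\, r=eR$. *)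

theory Defs
  imports "HOL-Algebra.Ring" "HOL-Algebra.Coset"
begin

locale reduced_ring = ring R for R (structure) +
  assumes reduced:
    "\<lbrakk>x \<in> carrier R; n > 0; x [^] (n::nat) = \<zero>\<rbrakk> \<Longrightarrow> x = \<zero>"

definition idempotents :: "('a, 'm) ring_scheme \<Rightarrow> 'a set" where
  "idempotents R = {e \<in> carrier R. e \<otimes>\<^bsub>R\<^esub> e = e}"

text \<open>The right annihilator; in a reduced ring it is also the left one
  (lemma \<open>ann_eq_left_ann\<close> below).\<close>

definition ann :: "('a, 'm) ring_scheme \<Rightarrow> 'a \<Rightarrow> 'a set" where
  "ann R r = {x \<in> carrier R. r \<otimes>\<^bsub>R\<^esub> x = \<zero>\<^bsub>R\<^esub>}"

locale weakly_baer_ring = reduced_ring R for R (structure) +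
  assumes weakly_baer:
    "r \<in> carrier R \<Longrightarrow> \<exists>e \<in> idempotents R. ann R r = e <# carrier R"

definition rr_order :: "('a, 'm) ring_scheme \<Rightarrow> 'a gorder" where
  "rr_order R = \<lparr>carrier = carrier R, eq = (=),
     le = (\<lambda>a b. a \<otimes>\<^bsub>R\<^esub> b = a \<otimes>\<^bsub>R\<^esub> a)\<rparr>"

text \<open>The infimum of \<open>r\<close> and \<open>s\<close> need not exist in general, so ``the infimum is zero''
  is expressed with the relation \<^const>\<open>is_glb\<close>.\<close>

definition rr_orthogonal :: "('a, 'm) ring_scheme \<Rightarrow> 'a \<Rightarrow> 'a \<Rightarrow> bool" where
  "rr_orthogonal R r s \<longleftrightarrow> is_glb (rr_order R) \<zero>\<^bsub>R\<^esub> {r, s}"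

definition rr_orthogonal_family :: "('a, 'm) ring_scheme \<Rightarrow> (nat \<Rightarrow> 'a) \<Rightarrow> bool" where
  "rr_orthogonal_family R r \<longleftrightarrow>
     (\<forall>n. r n \<in> carrier R) \<and> (\<forall>i j. i \<noteq> j \<longrightarrow> rr_orthogonal R (r i) (r j))"

context reduced_ring
begin

lemma square_zero: "\<lbrakk>x \<in> carrier R; x \<otimes> x = \<zero>\<rbrakk> \<Longrightarrow> x = \<zero>"
  using reduced[of x 2] by (simp add: numeral_2_eq_2)

lemma mult_zero_commute:
  assumes "x \<in> carrier R" "y \<in> carrier R" "x \<otimes> y = \<zero>"
  shows "y \<otimes> x = \<zero>"
proof (rule square_zero)
  have "(y \<otimes> x) \<otimes> (y \<otimes> x) = y \<otimes> (x \<otimes> y) \<otimes> x"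
    using assms(1,2) by (simp add: m_assoc)
  then show "(y \<otimes> x) \<otimes> (y \<otimes> x) = \<zero>"
    using assms by simp
qed (use assms in simp)

lemma mult_zero_insert:
  assumes "x \<in> carrier R" "y \<in> carrier R" "z \<in> carrier R" "x \<otimes> y = \<zero>"
  shows "x \<otimes> z \<otimes> y = \<zero>"
proof (rule square_zero)
  have "(x \<otimes> z \<otimes> y) \<otimes> (x \<otimes> z \<otimes> y) = x \<otimes> z \<otimes> (y \<otimes> x) \<otimes> (z \<otimes> y)"
    using assms(1-3) by (simp add: m_assoc)
  then show "(x \<otimes> z \<otimes> y) \<otimes> (x \<otimes> z \<otimes> y) = \<zero>"
    using assms mult_zero_commute[of x y] by simp
qed (use assms in simp)

lemma ann_eq_left_ann:
  "r \<in> carrier R \<Longrightarrow> ann R r = {x \<in> carrier R. x \<otimes> r = \<zero>}"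
  unfolding ann_def using mult_zero_commute by blast

lemma diff_zero_iff:
  assumes "a \<in> carrier R" "b \<in> carrier R"
  shows "a \<ominus> b = \<zero> \<longleftrightarrow> a = b"
  using assms by (metis a_minus_def add.inv_closed minus_minus minus_equality r_neg)

lemma rr_le_iff:
  assumes "a \<in> carrier R" "b \<in> carrier R"
  shows "a \<otimes> b = a \<otimes> a \<longleftrightarrow> a \<otimes> (b \<ominus> a) = \<zero>"
proof -
  have "a \<otimes> (b \<ominus> a) = a \<otimes> b \<ominus> a \<otimes> a"
    using assms by (simp add: minus_eq r_distr r_minus)
  then show ?thesis
    using assms by (simp add: diff_zero_iff)
qed

lemma rr_partial_order: "partial_order (rr_order R)"
proof -
  have antisym: "a = b"
    if "a \<otimes> b = a \<otimes> a" "b \<otimes> a = b \<otimes> b" and c: "a \<in> carrier R" "b \<in> carrier R" for a b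
  proof -
    have 1: "a \<otimes> (b \<ominus> a) = \<zero>"
      using that rr_le_iff by blast
    have "b \<otimes> (b \<ominus> a) = b \<otimes> b \<ominus> b \<otimes> a"
      using c by (simp add: minus_eq r_distr r_minus)
    then have 2: "b \<otimes> (b \<ominus> a) = \<zero>"
      using that(2) c by (simp add: diff_zero_iff)
    have "(b \<ominus> a) \<otimes> (b \<ominus> a) = b \<otimes> (b \<ominus> a) \<ominus> a \<otimes> (b \<ominus> a)"
      using c by (simp add: minus_eq l_distr l_minus)
    also have "\<dots> = \<zero>"
      unfolding 1 2 by (simp add: minus_eq)
    finally have "b \<ominus> a = \<zero>"
      using c square_zero[of "b \<ominus> a"] by blast
    then show ?thesis
      using c by (simp add: diff_zero_iff)
  qed
  have trans: "a \<otimes> c = a \<otimes> a"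
    if ab: "a \<otimes> b = a \<otimes> a" and bc: "b \<otimes> c = b \<otimes> b"
      and cl: "a \<in> carrier R" "b \<in> carrier R" "c \<in> carrier R" for a b c
  proof -
    let ?x = "c \<ominus> b"
    have x: "?x \<in> carrier R" using cl by simp
    have "b \<otimes> ?x = \<zero>"
      using bc cl rr_le_iff by blast
    then have 1: "b \<otimes> a \<otimes> ?x = \<zero>"
      using mult_zero_insert[of b ?x a] cl by simp
    have "(b \<ominus> a) \<otimes> a = \<zero>"
      using ab cl rr_le_iff mult_zero_commute[of a "b \<ominus> a"] by simp
    moreover have "(b \<ominus> a) \<otimes> a = b \<otimes> a \<ominus> a \<otimes> a"
      using cl by (simp add: minus_eq l_distr l_minus)
    ultimately have "b \<otimes> a = a \<otimes> a"
      using cl by (simp add: diff_zero_iff)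
    then have "a \<otimes> (a \<otimes> ?x) = \<zero>"
      using 1 cl x by (simp add: m_assoc)
    then have "(a \<otimes> ?x) \<otimes> a = \<zero>"
      using cl x mult_zero_commute[of a "a \<otimes> ?x"] by simp
    then have "(a \<otimes> ?x) \<otimes> (a \<otimes> ?x) = \<zero>"
      using cl x by (metis l_null m_assoc m_closed)
    then have "a \<otimes> ?x = \<zero>"
      using cl x square_zero[of "a \<otimes> ?x"] by simp
    moreover have "a \<otimes> ?x = a \<otimes> c \<ominus> a \<otimes> b"
      using cl by (simp add: minus_eq r_distr r_minus)
    ultimately show ?thesis
      using cl ab by (simp add: diff_zero_iff)
  qed
  show ?thesis
  proof unfold_locales
    fix a b
    assume "a \<sqsubseteq>\<^bsub>rr_order R\<^esub> b" "b \<sqsubseteq>\<^bsub>rr_order R\<^esub> a"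
      "a \<in> carrier (rr_order R)" "b \<in> carrier (rr_order R)"
    then show "a .=\<^bsub>rr_order R\<^esub> b"
      unfolding rr_order_def gorder.simps eq_object.simps partial_object.simps by (rule antisym)
  next
    fix a b c
    assume "a \<sqsubseteq>\<^bsub>rr_order R\<^esub> b" "b \<sqsubseteq>\<^bsub>rr_order R\<^esub> c"
      "a \<in> carrier (rr_order R)" "b \<in> carrier (rr_order R)" "c \<in> carrier (rr_order R)"
    then show "a \<sqsubseteq>\<^bsub>rr_order R\<^esub> c"
      unfolding rr_order_def gorder.simps eq_object.simps partial_object.simps by (rule trans)
  qed (simp_all add: rr_order_def)
qed

lemma rr_orthogonal_iff:
  assumes "r \<in> carrier R" "s \<in> carrier R"
  shows "rr_orthogonal R r s \<longleftrightarrow>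
    (\<forall>c \<in> carrier R. c \<otimes> r = c \<otimes> c \<and> c \<otimes> s = c \<otimes> c \<longrightarrow> c = \<zero>)"
proof -
  let ?L = "{c \<in> carrier R. c \<otimes> r = c \<otimes> c \<and> c \<otimes> s = c \<otimes> c}"
  have L: "Lower (rr_order R) {r, s} = ?L"
    unfolding Lower_def rr_order_def gorder.simps eq_object.simps partial_object.simps
    using assms by blast
  have "\<zero> \<in> ?L"
    using assms by simp
  moreover have "c \<otimes> \<zero> = c \<otimes> c \<longleftrightarrow> c = \<zero>" if "c \<in> carrier R" for c
    using that square_zero[of c] by (metis r_null)
  ultimately have "is_glb (rr_order R) \<zero> {r, s} \<longleftrightarrow> (\<forall>c \<in> ?L. c = \<zero>)"
    unfolding greatest_def L unfolding rr_order_def gorder.simps eq_object.simps partial_object.simps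
    by blast
  then show ?thesis
    unfolding rr_orthogonal_def by blast
qed

end

end

theory Submission
  imports Defs "HOL-Algebra.RingHom"
begin

text \<open>
  For arbitrary lifts \<open>t n\<close> of \<open>s n\<close>, write \<open>ann (t i \<ominus> t j) = e i j R\<close> with \<open>e i j\<close> idempotent.
  Every common lower bound of \<open>t i\<close> and \<open>t j\<close> is a multiple of \<open>e i j\<close>, and
  \<open>\<phi> (e i j) \<otimes> s j\<close> is a common lower bound of \<open>s i\<close> and \<open>s j\<close>, hence zero.
  So multiplying \<open>t n\<close> by \<open>\<one> \<ominus> e i n\<close> for all \<open>i < n\<close> makes the family orthogonal
  and leaves the images under \<open>\<phi>\<close> unchanged.
\<close>

context reduced_ring
begin

text \<open>Inserting \<open>x\<close> into the zero products of \<open>e\<close> and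
  \<open>\<one> \<ominus> e\<close> shows that \<open>x \<otimes> e\<close> and
  \<open>e \<otimes> x\<close> both equal \<open>e \<otimes> x \<otimes> e\<close>.\<close>

lemma idempotent_central:
  assumes "e \<in> idempotents R" "x \<in> carrier R"
  shows "x \<otimes> e = e \<otimes> x"
proof -
  have e: "e \<in> carrier R" "e \<otimes> e = e"
    using assms(1) by (auto simp: idempotents_def)
  have "(\<one> \<ominus> e) \<otimes> e = \<zero>" "e \<otimes> (\<one> \<ominus> e) = \<zero>"
    using e by (simp_all add: minus_eq l_distr r_distr l_minus r_minus r_neg)
  then have "(\<one> \<ominus> e) \<otimes> x \<otimes> e = \<zero>" "e \<otimes> x \<otimes> (\<one> \<ominus> e) = \<zero>"
    using e assms(2) by (simp_all add: mult_zero_insert)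
  moreover have "(\<one> \<ominus> e) \<otimes> x \<otimes> e = x \<otimes> e \<ominus> e \<otimes> x \<otimes> e"
    "e \<otimes> x \<otimes> (\<one> \<ominus> e) = e \<otimes> x \<ominus> e \<otimes> x \<otimes> e"
    using e assms(2) by (simp_all add: minus_eq l_distr r_distr l_minus r_minus)
  ultimately show ?thesis
    using e assms(2) by (simp add: diff_zero_iff)
qed

lemma rr_le_trans:
  assumes "a \<in> carrier R" "b \<in> carrier R" "c \<in> carrier R"
    and "a \<otimes> b = a \<otimes> a" "b \<otimes> c = b \<otimes> b"
  shows "a \<otimes> c = a \<otimes> a"
proof -
  interpret partial_order "rr_order R"
    by (rule rr_partial_order)
  show ?thesis
    using le_trans[of a b c] assms by (simp add: rr_order_def)
qed

text \<open>In unfolded form this says that \<open>e \<otimes> x\<close> lies rr-below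
  \<open>x\<close>; it is the source of lower bounds below.\<close>

lemma idempotent_mult_rr_le:
  assumes "e \<in> idempotents R" "x \<in> carrier R"
  shows "e \<otimes> x \<otimes> x = e \<otimes> x \<otimes> (e \<otimes> x)"
proof -
  have e: "e \<in> carrier R" "e \<otimes> e = e"
    using assms(1) by (auto simp: idempotents_def)
  have "e \<otimes> x \<otimes> (e \<otimes> x) = e \<otimes> (x \<otimes> e) \<otimes> x"
    using e assms(2) by (simp add: m_assoc)
  also have "\<dots> = e \<otimes> e \<otimes> x \<otimes> x"
    unfolding idempotent_central[OF assms] using e(1) assms(2) by (simp add: m_assoc)
  finally show ?thesis
    using e by simp
qed

lemma one_minus_idempotent:
  assumes "e \<in> idempotents R"
  shows "\<one> \<ominus> e \<in> idempotents R"
proof -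
  have e: "e \<in> carrier R" "e \<otimes> e = e"
    using assms by (auto simp: idempotents_def)
  have "(\<one> \<ominus> e) \<otimes> e = \<zero>"
    using e by (simp add: minus_eq l_distr l_minus r_neg)
  moreover have "(\<one> \<ominus> e) \<otimes> (\<one> \<ominus> e) = (\<one> \<ominus> e) \<ominus> (\<one> \<ominus> e) \<otimes> e"
    using e(1) by (simp add: minus_eq r_distr r_minus)
  ultimately show ?thesis
    using e(1) by (simp add: idempotents_def minus_eq)
qed

lemma rr_orthogonal_commute: "rr_orthogonal R x y \<longleftrightarrow> rr_orthogonal R y x"
  by (simp add: rr_orthogonal_def insert_commute)

text \<open>The common value \<open>e \<otimes> x = e \<otimes> y\<close> lies rr-below both
  \<open>x\<close> and \<open>y\<close>, so orthogonality forces it to vanish.\<close>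

lemma rr_orthogonal_idempotent_mult:
  assumes "x \<in> carrier R" "y \<in> carrier R" "rr_orthogonal R x y"
    and "e \<in> idempotents R" "e \<otimes> x = e \<otimes> y"
  shows "e \<otimes> y = \<zero>"
proof -
  have "e \<in> carrier R"
    using assms(4) by (simp add: idempotents_def)
  then show ?thesis
    using assms rr_orthogonal_iff[OF assms(1,2)] idempotent_mult_rr_le[OF assms(4)]
    by (metis m_closed)
qed

text \<open>A common lower bound \<open>c\<close> of \<open>r\<close> and \<open>r'\<close> is also
  one of \<open>t\<close> and \<open>t'\<close>, so it kills their difference and is a multiple of
  \<open>e\<close>. Since \<open>e\<close> kills \<open>r'\<close>, this gives
  \<open>c \<otimes> c = c \<otimes> r' = \<zero>\<close>. Only one of the two elements has to be
  killed by \<open>e\<close>.\<close>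

lemma rr_orthogonal_ann:
  assumes t: "t \<in> carrier R" "t' \<in> carrier R"
    and e: "e \<in> idempotents R" "ann R (t \<ominus> t') = e <# carrier R"
    and r: "r \<in> carrier R" "r \<otimes> t = r \<otimes> r"
    and r': "r' \<in> carrier R" "r' \<otimes> t' = r' \<otimes> r'" "e \<otimes> r' = \<zero>"
  shows "rr_orthogonal R r r'"
proof -
  have ec: "e \<in> carrier R" "e \<otimes> e = e"
    using e(1) by (auto simp: idempotents_def)
  have "c = \<zero>"
    if c: "c \<in> carrier R" "c \<otimes> r = c \<otimes> c" "c \<otimes> r' = c \<otimes> c" for c
  proof -
    have "c \<otimes> t = c \<otimes> c" "c \<otimes> t' = c \<otimes> c"
      using rr_le_trans[of c r t] rr_le_trans[of c r' t'] c r r' t by simp_all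
    then have "c \<otimes> (t \<ominus> t') = \<zero>"
      using c(1) t by (simp add: minus_eq r_distr r_minus r_neg)
    \<comment> \<open>Here \<open>c\<close> stands on the left of the product, whereas
      \<open>ann\<close> is defined with it on the right; reducedness identifies the two
      annihilators.\<close>
    then have "c \<in> e <# carrier R"
      using c(1) t ann_eq_left_ann[of "t \<ominus> t'"] e(2) by simp
    then obtain y where y: "y \<in> carrier R" "c = e \<otimes> y"
      by (auto simp: l_coset_def)
    have "e \<otimes> c = c"
      unfolding y(2) using ec y(1) by (simp add: m_assoc[symmetric])
    then have "c \<otimes> r' = c \<otimes> e \<otimes> r'"
      using idempotent_central[OF e(1) c(1)] by simp
    also have "\<dots> = \<zero>"
      using c(1) ec(1) r'(1,3) by (simp add: m_assoc)
    finally show ?thesis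
      using c square_zero[of c] by simp
  qed
  then show ?thesis
    using rr_orthogonal_iff[OF r(1) r'(1)] by blast
qed

end

text \<open>Induction on \<open>n\<close>: each step multiplies by
  \<open>\<one> \<ominus> e n\<close>. This moves down in the rr-order, and it preserves the image
  because \<open>\<phi> (e n)\<close> kills \<open>\<phi> t\<close>.\<close>

lemma rr_le_lift_annihilated:
  fixes R :: "('a, 'm) ring_scheme" (structure) and S :: "('b, 'n) ring_scheme"
    and n :: nat
  assumes "reduced_ring R" "ring S" "\<phi> \<in> ring_hom R S" "t \<in> carrier R"
    and "\<And>i. i < n \<Longrightarrow> e i \<in> idempotents R"
    and "\<And>i. i < n \<Longrightarrow> \<phi> (e i) \<otimes>\<^bsub>S\<^esub> \<phi> t = \<zero>\<^bsub>S\<^esub>"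
  shows "\<exists>r \<in> carrier R. r \<otimes> t = r \<otimes> r \<and> \<phi> r = \<phi> t \<and> (\<forall>i<n. e i \<otimes> r = \<zero>)"
  using assms(5,6)
proof (induction n)
  case 0
  then show ?case
    using assms(4) by auto
next
  case (Suc n)
  interpret R: reduced_ring R by fact
  interpret S: ring S by fact
  interpret \<phi>: ring_hom_ring R S \<phi>
    using assms(3) by (intro ring_hom_ringI2 R.ring_axioms S.ring_axioms)
  obtain r where r: "r \<in> carrier R" "r \<otimes> t = r \<otimes> r" "\<phi> r = \<phi> t"
    "\<forall>i<n. e i \<otimes> r = \<zero>"
    using Suc by auto
  have e: "e i \<in> carrier R" "e i \<otimes> e i = e i" if "i < Suc n" for i
    using Suc.prems(1)[OF that] by (auto simp: idempotents_def)
  let ?f = "\<one> \<ominus> e n"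
  let ?q = "?f \<otimes> r"
  have f: "?f \<in> idempotents R"
    using Suc.prems(1) by (simp add: R.one_minus_idempotent)
  have fc: "?f \<in> carrier R"
    using f by (simp add: idempotents_def)
  \<comment> \<open>Transitivity along \<open>?q\<close>, \<open>r\<close>, \<open>t\<close> in the
    rr-order.\<close>
  have "?q \<otimes> t = ?q \<otimes> ?q"
    using R.rr_le_trans[of ?q r t] R.idempotent_mult_rr_le[OF f r(1)] r(1,2) fc assms(4)
    by simp
  moreover have "\<phi> ?q = \<phi> t"
  proof -
    have "?q = r \<ominus> e n \<otimes> r"
      using e r(1) by (simp add: R.minus_eq R.l_distr R.l_minus)
    then have "\<phi> ?q = \<phi> r \<ominus>\<^bsub>S\<^esub> \<phi> (e n) \<otimes>\<^bsub>S\<^esub> \<phi> r"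
      using e r(1) by (simp add: R.minus_eq S.minus_eq)
    then show ?thesis
      using Suc.prems(2)[of n] r(3) assms(4) by (simp add: S.minus_eq)
  qed
  moreover have "e i \<otimes> ?q = \<zero>" if "i < Suc n" for i
  proof -
    \<comment> \<open>With the central factor \<open>?f\<close> in front, the induction hypothesis
      settles \<open>i < n\<close>, and \<open>?f \<otimes> e n = \<zero>\<close> settles
      \<open>i = n\<close>.\<close>
    have "e i \<otimes> ?q = ?f \<otimes> (e i \<otimes> r)"
      using R.idempotent_central[OF f, of "e i"] e[OF that] r(1) fc
      by (simp add: R.m_assoc[symmetric])
    moreover have "?f \<otimes> e n = \<zero>"
      using e[of n] by (simp add: R.minus_eq R.l_distr R.l_minus R.r_neg)
    ultimately show ?thesis
      using that r(1,4) fc e[of n] by (cases "i = n") (simp_all add: R.m_assoc[symmetric])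
  qed
  ultimately show ?case
    using fc r(1) by blast
qed

theorem theorem2p10:
  fixes R :: "('a, 'm) ring_scheme" and S :: "('b, 'n) ring_scheme"
    and \<phi> :: "'a \<Rightarrow> 'b" and s :: "nat \<Rightarrow> 'b"
  assumes "weakly_baer_ring R" and "reduced_ring S"
    and "\<phi> \<in> ring_hom R S" and "\<phi> ` carrier R = carrier S"
    and "\<phi> ` idempotents R = idempotents S"
    and "rr_orthogonal_family S s"
  shows "\<exists>r. rr_orthogonal_family R r \<and> (\<forall>n. \<phi> (r n) = s n)"
proof -
  interpret R: weakly_baer_ring R by fact
  interpret S: reduced_ring S by fact
  interpret \<phi>: ring_hom_ring R S \<phi>
    using assms(3) by (intro ring_hom_ringI2 R.ring_axioms S.ring_axioms)
  have s: "s n \<in> carrier S" "i \<noteq> j \<Longrightarrow> rr_orthogonal S (s i) (s j)" for n i j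
    using assms(6) by (auto simp: rr_orthogonal_family_def)
  have "\<forall>n. \<exists>x \<in> carrier R. \<phi> x = s n"
    using s(1) assms(4) by (metis imageE)
  then obtain t where t: "\<And>n. t n \<in> carrier R" "\<And>n. \<phi> (t n) = s n"
    by metis
  have "\<forall>i j. \<exists>e \<in> idempotents R. ann R (t i \<ominus>\<^bsub>R\<^esub> t j) = e <#\<^bsub>R\<^esub> carrier R"
    using t(1) by (intro allI R.weakly_baer) simp
  then obtain e where e: "\<And>i j. e i j \<in> idempotents R"
    "\<And>i j. ann R (t i \<ominus>\<^bsub>R\<^esub> t j) = e i j <#\<^bsub>R\<^esub> carrier R"
    by metis
  have ec: "e i j \<in> carrier R" for i j
    using e(1) by (simp add: idempotents_def)
  have es: "\<phi> (e i j) \<otimes>\<^bsub>S\<^esub> \<phi> (t j) = \<zero>\<^bsub>S\<^esub>" if "i < j" for i j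
  proof -
    \<comment> \<open>The generator \<open>e i j\<close> itself lies in the annihilator, so it
      equalizes \<open>t i\<close> and \<open>t j\<close>; applying \<open>\<phi>\<close> brings the
      orthogonality of \<open>s i\<close> and \<open>s j\<close> into play.\<close>
    have "e i j \<otimes>\<^bsub>R\<^esub> \<one>\<^bsub>R\<^esub> \<in> e i j <#\<^bsub>R\<^esub> carrier R"
      unfolding l_coset_def using R.one_closed by blast
    then have "e i j \<in> ann R (t i \<ominus>\<^bsub>R\<^esub> t j)"
      unfolding e(2) R.r_one[OF ec] .
    then have "e i j \<otimes>\<^bsub>R\<^esub> (t i \<ominus>\<^bsub>R\<^esub> t j) = \<zero>\<^bsub>R\<^esub>"
      using R.ann_eq_left_ann[of "t i \<ominus>\<^bsub>R\<^esub> t j"] t(1) by simp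
    then have "e i j \<otimes>\<^bsub>R\<^esub> t i \<ominus>\<^bsub>R\<^esub> e i j \<otimes>\<^bsub>R\<^esub> t j = \<zero>\<^bsub>R\<^esub>"
      using ec t(1) by (simp add: R.minus_eq R.r_distr R.r_minus)
    then have "e i j \<otimes>\<^bsub>R\<^esub> t i = e i j \<otimes>\<^bsub>R\<^esub> t j"
      using ec t(1) by (simp add: R.diff_zero_iff)
    then have "\<phi> (e i j) \<otimes>\<^bsub>S\<^esub> s i = \<phi> (e i j) \<otimes>\<^bsub>S\<^esub> s j"
      using ec t by (metis \<phi>.hom_mult)
    moreover have "\<phi> (e i j) \<in> idempotents S"
      using e(1) assms(5) by blast
    ultimately show ?thesis
      unfolding t(2) using that S.rr_orthogonal_idempotent_mult[OF s(1) s(1) s(2), of i j]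
      by blast
  qed
  \<comment> \<open>The index \<open>n\<close> also bounds the number of idempotents, so each
    \<open>t n\<close> needs only finitely many corrections, one for each earlier index.\<close>
  have "\<forall>n. \<exists>r \<in> carrier R. r \<otimes>\<^bsub>R\<^esub> t n = r \<otimes>\<^bsub>R\<^esub> r \<and> \<phi> r = \<phi> (t n) \<and>
      (\<forall>i<n. e i n \<otimes>\<^bsub>R\<^esub> r = \<zero>\<^bsub>R\<^esub>)"
    using R.reduced_ring_axioms S.ring_axioms assms(3) t(1) e(1) es
    by (intro allI rr_le_lift_annihilated) auto
  then obtain r where r: "\<And>n. r n \<in> carrier R"
    "\<And>n. r n \<otimes>\<^bsub>R\<^esub> t n = r n \<otimes>\<^bsub>R\<^esub> r n" "\<And>n. \<phi> (r n) = \<phi> (t n)"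
    "\<And>n i. i < n \<Longrightarrow> e i n \<otimes>\<^bsub>R\<^esub> r n = \<zero>\<^bsub>R\<^esub>"
    by metis
  \<comment> \<open>The later element \<open>r j\<close> is the one killed by \<open>e i j\<close>;
    of \<open>r i\<close> only its position below \<open>t i\<close> is used. Symmetry then covers
    \<open>j < i\<close>.\<close>
  have orth: "rr_orthogonal R (r i) (r j)" if "i < j" for i j
    by (rule R.rr_orthogonal_ann[OF t(1) t(1) e r(1,2) r(1,2) r(4)[OF that]])
  then have "rr_orthogonal R (r i) (r j)" if "i \<noteq> j" for i j
    using that R.rr_orthogonal_commute by (metis linorder_neqE_nat)
  then show ?thesis
    using r(1,3) t(2) by (auto simp: rr_orthogonal_family_def)
qed

end
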